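(* Let $T_0$ be a rooted tree on $n_0\ge2$ vertices and $q_2\in(0,1)$. Consider the single model and the binomial model (with parameter $q_2$) of the employee-firing chain started at $T_0$, whose state space is the set of rooted subtrees of $T_0$. Then: (i) The eigenvalues of the single model are $\frac{j}{n_0}$ and those of the binomial model are $q_2^{n_0-j}$, for $0\le j\le n_0-2$ and $j=n_0$. (ii) The eigenvalue $1$ ($j=n_0$) has multiplicity $1$; for $0\le j\le n_0-2$ the multiplicity of the eigenvalue indexed by $j$ is the number of rooted subtrees of $T_0$ on $n_0-j$ vertices. (iii) For a rooted subtree $T'\neq\bullet$ of $T_0$ on $n'$ vertices, the function on states $$\mathbf f_{T'}(T):=\binom{n}{n'}\,\mathrm{Prob}\Big(\text{after firing } n-n' \text{ uniformly chosen employees (with promotion cascades) from } T \text{, the remaining structure is } T'\Big),$$ where $n$ is the number of vertices of $T$ (and $\mathbf f_{T'}(T)=0$ if $n<n'$), is a right eigenfunction of the single (resp. binomial) model with eigenvalue $\frac{n_0-n'}{n_0}$ (resp. $q_2^{n'}$). These functions, together with the constant function $1$, form a basis of right eigenfunctions.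
   Context: A rooted subtree of $T_0$ is a connected set of vertices of $T_0$ containing the root, with the induced rooted tree structure; $\bullet$ denotes the subtree consisting of the root only. Vertices are positions in a company, the root being the boss; each vertex is occupied by one employee. Hook of a vertex $v$: $v$ together with all its descendants. Promotion cascade after the employee at vertex $v$ of the current tree $T$ is fired: set $u:=v$; while $u$ has children, choose $w$ uniformly among the strict descendants of $u$, promote the employee at $w$ to $u$, and set $u:=w$; finally the vertex $u$ (a leaf) is deleted, so the new state is $T$ minus that leaf. If $T=\bullet$ no firing ever occurs. Single model: from state $T$ with $n$ vertices, with probability $n/n_0$ a uniformly chosen employee is fired (followed by its promotion cascade), and with probability $(n_0-n)/n_0$ nothing changes. Binomial model: from state $T$, each employee independently is fired with probability $1-q_2$; the fired employees are fired one by one in uniformly random order, each firing followed by its promotion cascade (no firing occurs once only the boss remains). A right eigenfunction with eigenvalue $\beta$ of a chain with transition matrix $K$ is $\mathbf f$ with $\sum_yK(x,y)\mathbf f(y)=\beta\mathbf f(x)$ for all states $x$. *)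

theory Defs
  imports
    "HOL-Probability.Probability"
    "HOL-Combinatorics.Multiset_Permutations"
    "Jordan_Normal_Form.Spectral_Radius"
    "Jordan_Normal_Form.Matrix_Kernel"
begin

(* V: vertices, r: root, E: pairs (parent, child). *)
locale rooted_tree =
  fixes V :: "'v set" and r :: 'v and E :: "('v \<times> 'v) set"
  assumes finite_vertices: "finite V"
    and root_in: "r \<in> V"
    and edges_in: "E \<subseteq> V \<times> V"
    and root_no_parent: "(u, r) \<notin> E"
    and unique_parent: "(u, w) \<in> E \<Longrightarrow> (u', w) \<in> E \<Longrightarrow> u = u'"
    and reachable: "v \<in> V \<Longrightarrow> (r, v) \<in> E\<^sup>*"
begin

definition connected_vertices :: "'v set \<Rightarrow> bool" where
  "connected_vertices S \<longleftrightarrow> (\<forall>u\<in>S. \<forall>v\<in>S. (u, v) \<in> ((E \<union> E\<inverse>) \<inter> S \<times> S)\<^sup>*)"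

definition rooted_subtrees :: "'v set set" where
  "rooted_subtrees = {S. S \<subseteq> V \<and> r \<in> S \<and> connected_vertices S}"

definition children :: "'v set \<Rightarrow> 'v \<Rightarrow> 'v set" where
  "children T u = {w. (u, w) \<in> E \<inter> T \<times> T}"

definition strict_descendants :: "'v set \<Rightarrow> 'v \<Rightarrow> 'v set" where
  "strict_descendants T u = {w. (u, w) \<in> (E \<inter> T \<times> T)\<^sup>+}"

lemma acyclic_edges: "(v, v) \<notin> E\<^sup>+"
proof
  assume cyc: "(v, v) \<in> E\<^sup>+"
  have no: "(x, x) \<notin> E\<^sup>+" if "(r, x) \<in> E\<^sup>*" for x
    using that
  proof (induction rule: rtrancl_induct)
    case base
    show ?case using root_no_parent by (meson tranclE)
  next
    case (step y z)
    show ?case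
    proof
      assume "(z, z) \<in> E\<^sup>+"
      then obtain w where w: "(z, w) \<in> E\<^sup>*" "(w, z) \<in> E" by (meson tranclD2)
      with step.hyps(2) have "w = y" using unique_parent by blast
      with w step.hyps(2) have "(y, y) \<in> E\<^sup>+" by (meson rtrancl_into_trancl2)
      with step.IH show False by blast
    qed
  qed
  from cyc edges_in have "v \<in> V" by (meson mem_Sigma_iff subsetD tranclD)
  with no reachable cyc show False by blast
qed

lemma finite_strict_descendants: "finite (strict_descendants T u)"
proof -
  have "(E \<inter> T \<times> T)\<^sup>+ \<subseteq> E\<^sup>+" by (intro trancl_mono_subset) auto
  also have "\<dots> \<subseteq> V \<times> V" using edges_in by (rule trancl_subset_Sigma)
  finally have "strict_descendants T u \<subseteq> V" by (auto simp: strict_descendants_def)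
  then show ?thesis using finite_vertices finite_subset by blast
qed

lemma strict_descendants_psubset:
  assumes "w \<in> strict_descendants T u"
  shows "strict_descendants T w \<subset> strict_descendants T u"
proof
  show "strict_descendants T w \<subseteq> strict_descendants T u"
    using assms by (auto simp: strict_descendants_def)
  have "(E \<inter> T \<times> T)\<^sup>+ \<subseteq> E\<^sup>+" by (intro trancl_mono_subset) auto
  then have "w \<notin> strict_descendants T w"
    using acyclic_edges[of w] by (auto simp: strict_descendants_def)
  with assms show "strict_descendants T w \<noteq> strict_descendants T u" by blast
qed

lemma strict_descendants_nonempty:
  "children T u \<noteq> {} \<Longrightarrow> strict_descendants T u \<noteq> {}"
  by (auto simp: children_def strict_descendants_def)

(* \<sigma> v is the employee occupying vertex v (only its values on the current tree matter). *)
function cascade :: "'v set \<Rightarrow> ('v \<Rightarrow> 'e) \<Rightarrow> 'v \<Rightarrow> ('v set \<times> ('v \<Rightarrow> 'e)) pmf" where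
  "cascade T \<sigma> u =
     (if children T u = {} then return_pmf (T - {u}, \<sigma>)
      else bind_pmf (pmf_of_set (strict_descendants T u))
             (\<lambda>w. cascade T (\<sigma>(u := \<sigma> w)) w))"
  by auto
termination
proof (relation "Wellfounded.measure (\<lambda>(T, \<sigma>, u). card (strict_descendants T u))")
  fix T :: "'v set" and \<sigma> :: "'v \<Rightarrow> 'e" and u w
  assume "children T u \<noteq> {}" "w \<in> set_pmf (pmf_of_set (strict_descendants T u))"
  then have "w \<in> strict_descendants T u"
    by (simp add: set_pmf_of_set strict_descendants_nonempty finite_strict_descendants)
  then show "((T, \<sigma>(u := \<sigma> w), w), (T, \<sigma>, u))
      \<in> Wellfounded.measure (\<lambda>(T, \<sigma>, u). card (strict_descendants T u))"
    by (simp add: psubset_card_mono finite_strict_descendants strict_descendants_psubset)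
qed simp

declare cascade.simps [simp del]

definition fire :: "'e \<Rightarrow> 'v set \<times> ('v \<Rightarrow> 'e) \<Rightarrow> ('v set \<times> ('v \<Rightarrow> 'e)) pmf" where
  "fire e = (\<lambda>(T, \<sigma>). if T = {r} then return_pmf (T, \<sigma>)
                      else cascade T \<sigma> (THE v. v \<in> T \<and> \<sigma> v = e))"

primrec fire_list ::
    "'e list \<Rightarrow> 'v set \<times> ('v \<Rightarrow> 'e) \<Rightarrow> ('v set \<times> ('v \<Rightarrow> 'e)) pmf" where
  "fire_list [] c = return_pmf c"
| "fire_list (e # es) c = bind_pmf (fire e c) (fire_list es)"

(* The employees of T are named after their initial positions, so the initial occupation is id.
   The employees in A keep their names while being promoted, and are fired in a uniformly
   random order. *)
definition fire_set :: "'v set \<Rightarrow> 'v set \<Rightarrow> 'v set pmf" where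
  "fire_set A T =
     bind_pmf (pmf_of_set (permutations_of_set A)) (\<lambda>es. map_pmf fst (fire_list es (T, id)))"

definition single_model :: "'v set \<Rightarrow> 'v set pmf" where
  "single_model T =
     bind_pmf (bernoulli_pmf (real (card T) / real (card V)))
       (\<lambda>b. if b then bind_pmf (pmf_of_set T) (\<lambda>e. map_pmf fst (fire e (T, id)))
            else return_pmf T)"

definition binomial_model :: "real \<Rightarrow> 'v set \<Rightarrow> 'v set pmf" where
  "binomial_model q T =
     bind_pmf (Pi_pmf T False (\<lambda>_. bernoulli_pmf (1 - q))) (\<lambda>b. fire_set {e \<in> T. b e} T)"

definition fire_uniform :: "nat \<Rightarrow> 'v set \<Rightarrow> 'v set pmf" where
  "fire_uniform m T = bind_pmf (pmf_of_set {A. A \<subseteq> T \<and> card A = m}) (\<lambda>A. fire_set A T)"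

definition tree_eigenfunction :: "'v set \<Rightarrow> 'v set \<Rightarrow> real" where
  "tree_eigenfunction T' T =
     (if card T < card T' then 0
      else real (card T choose card T') * pmf (fire_uniform (card T - card T') T) T')"

end

definition right_eigenfunction ::
    "'s set \<Rightarrow> ('s \<Rightarrow> 's pmf) \<Rightarrow> real \<Rightarrow> ('s \<Rightarrow> real) \<Rightarrow> bool" where
  "right_eigenfunction S K \<beta> f \<longleftrightarrow>
     (\<exists>x\<in>S. f x \<noteq> 0) \<and> (\<forall>x\<in>S. (\<Sum>y\<in>S. pmf (K x) y * f y) = \<beta> * f x)"

(* xs enumerates the states. *)
definition transition_matrix :: "'s list \<Rightarrow> ('s \<Rightarrow> 's pmf) \<Rightarrow> real mat" where
  "transition_matrix xs K = mat (length xs) (length xs) (\<lambda>(i, j). pmf (K (xs ! i)) (xs ! j))"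

definition state_vec :: "'s list \<Rightarrow> ('s \<Rightarrow> real) \<Rightarrow> real vec" where
  "state_vec xs f = vec (length xs) (\<lambda>i. f (xs ! i))"

definition algebraic_multiplicity :: "real mat \<Rightarrow> real \<Rightarrow> nat" where
  "algebraic_multiplicity A \<beta> = Polynomial.order \<beta> (char_poly A)"

definition geometric_multiplicity :: "real mat \<Rightarrow> real \<Rightarrow> nat" where
  "geometric_multiplicity A \<beta> = kernel_dim (char_matrix A \<beta>)"

definition has_multiplicity :: "real mat \<Rightarrow> real \<Rightarrow> nat \<Rightarrow> bool" where
  "has_multiplicity A \<beta> m \<longleftrightarrow>
     algebraic_multiplicity A \<beta> = m \<and> geometric_multiplicity A \<beta> = m"

definition function_basis :: "'s list \<Rightarrow> ('s \<Rightarrow> real) set \<Rightarrow> bool" where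
  "function_basis xs F \<longleftrightarrow>
     inj_on (state_vec xs) F \<and>
     vectorspace.basis class_ring (module_vec TYPE(real) (length xs)) (state_vec xs ` F)"

end

theory Submission
  imports Defs "Jordan_Normal_Form.Jordan_Normal_Form_Uniqueness"
begin

text \<open>
  Firing a uniformly chosen employee removes exactly one vertex, and the employees that remain are
  exchangeable; hence firing \<^term>\<open>m\<close> uniformly chosen employees amounts to \<^term>\<open>m\<close> steps of
  a Markov kernel that lowers the size by one. Both models are mixtures of powers of this kernel,
  with weights depending only on the size, so the eigenfunction equations reduce to the identities
  $(n - n') \binom{n}{n'} = n \binom{n-1}{n'}$ and
  $\binom{n}{m} \binom{n-m}{n'} = \binom{n}{n'} \binom{n-n'}{m}$, whatever the promotion rule is.
  The eigenfunctions, together with the constant function, are triangular with respect to size.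
  Therefore they form a basis, and the transition matrices are diagonalizable.
\<close>

section \<open>Triangular families of eigenfunctions\<close>

text \<open>Blocks of size 1 have no superdiagonal entry. Diagonalizability is later phrased as a
  Jordan normal form with such blocks, from which both multiplicities can be read off.\<close>

lemma jordan_matrix_singleton_blocks:
  fixes ds :: "'a :: {zero, one} list"
  shows "jordan_matrix (map (Pair 1) ds) =
    mat (length ds) (length ds) (\<lambda>(i, j). if i = j then ds ! i else 0)"
proof (induction ds)
  case Nil
  then show ?case by (intro eq_matI) (auto simp: jordan_matrix_def)
next
  case (Cons d ds)
  have len: "sum_list (map fst (map (Pair 1) ds)) = length ds" for ds :: "'a list"
    by (induction ds) auto
  show ?case
    by (intro eq_matI)
      (auto simp: jordan_matrix_Cons Cons.IH len four_block_mat_def Let_def jordan_block_def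
        nth_Cons' simp del: map_map One_nat_def)
qed

text \<open>\<open>g t\<close> is the eigenfunction attached to the state \<open>t\<close> and
  \<open>d t\<close> its eigenvalue. Triangularity refers to sizes only, so no linear order of the
  states has to be chosen.\<close>

locale triangular_eigenfunctions =
  fixes xs :: "'s list" and sz :: "'s \<Rightarrow> nat" and K :: "'s \<Rightarrow> 's pmf"
    and g :: "'s \<Rightarrow> 's \<Rightarrow> real" and d :: "'s \<Rightarrow> real"
  assumes distinct_states: "distinct xs"
    and diagonal: "t \<in> set xs \<Longrightarrow> g t t \<noteq> 0"
    and triangular: "s \<in> set xs \<Longrightarrow> t \<in> set xs \<Longrightarrow> s \<noteq> t \<Longrightarrow> sz s \<le> sz t \<Longrightarrow> g t s = 0"
    and eigen: "s \<in> set xs \<Longrightarrow> t \<in> set xs \<Longrightarrow>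
      (\<Sum>y\<in>set xs. pmf (K s) y * g t y) = d t * g t s"
begin

definition eigenmatrix :: "real mat" where
  "eigenmatrix = mat (length xs) (length xs) (\<lambda>(i, j). g (xs ! j) (xs ! i))"

lemma eigenmatrix_carrier [simp]: "eigenmatrix \<in> carrier_mat (length xs) (length xs)"
  by (simp add: eigenmatrix_def)

text \<open>Since \<open>xs\<close> need not be sorted by size, the matrix is not literally
  triangular; induction on the size shows instead that its kernel is trivial.\<close>

lemma det_eigenmatrix: "det eigenmatrix \<noteq> 0"
proof
  assume "det eigenmatrix = 0"
  then obtain v where v: "v \<in> carrier_vec (length xs)" "v \<noteq> 0\<^sub>v (length xs)"
    "eigenmatrix *\<^sub>v v = 0\<^sub>v (length xs)"
    using det_0_iff_vec_prod_zero_field[OF eigenmatrix_carrier] by blast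
  have "v $ i = 0" if "i < length xs" for i
    using that
  proof (induction "sz (xs ! i)" arbitrary: i rule: less_induct)
    case less
    have "0 = (eigenmatrix *\<^sub>v v) $ i" using v less.prems by simp
    also have "\<dots> = (\<Sum>j<length xs. g (xs ! j) (xs ! i) * v $ j)"
      using v(1) less.prems
      by (auto simp: eigenmatrix_def scalar_prod_def lessThan_atLeast0 intro!: sum.cong)
    \<comment> \<open>Off the diagonal, \<open>v $ j\<close> vanishes by induction for smaller
      states, and \<open>g (xs ! j) (xs ! i)\<close> vanishes by triangularity for the
      others.\<close>
    also have "\<dots> = (\<Sum>j\<in>{i}. g (xs ! j) (xs ! i) * v $ j)"
    proof (rule sum.mono_neutral_right)
      show "\<forall>j\<in>{..<length xs} - {i}. g (xs ! j) (xs ! i) * v $ j = 0"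
      proof
        fix j assume j: "j \<in> {..<length xs} - {i}"
        then have "xs ! i \<noteq> xs ! j"
          using less.prems distinct_states by (auto simp: nth_eq_iff_index_eq)
        then show "g (xs ! j) (xs ! i) * v $ j = 0"
          using less j triangular[of "xs ! i" "xs ! j"]
          by (cases "sz (xs ! j) < sz (xs ! i)") auto
      qed
    qed (use less.prems in auto)
    finally show ?case using diagonal[of "xs ! i"] less.prems by simp
  qed
  then have "v = 0\<^sub>v (length xs)" using v(1) by (intro eq_vecI) auto
  with v(2) show False by simp
qed

lemma cols_eigenmatrix: "cols eigenmatrix = map (\<lambda>t. state_vec xs (g t)) xs"
  by (intro nth_equalityI) (auto simp: eigenmatrix_def state_vec_def intro!: eq_vecI)

text \<open>Passing to the set of columns must not lose any of them; two equal columns would make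
  the determinant vanish.\<close>

lemma distinct_cols_eigenmatrix: "distinct (cols eigenmatrix)"
proof -
  have "col eigenmatrix i \<noteq> col eigenmatrix j" if "i < length xs" "j < length xs" "i \<noteq> j" for i j
    using det_identical_columns[OF eigenmatrix_carrier that(3,1,2)] det_eigenmatrix by blast
  moreover have "dim_col eigenmatrix = length xs" by (simp add: eigenmatrix_def)
  ultimately show ?thesis by (auto simp: distinct_conv_nth)
qed

lemma inj_on_state_vec_eigenfunctions: "inj_on (\<lambda>t. state_vec xs (g t)) (set xs)"
  using distinct_cols_eigenmatrix by (simp add: cols_eigenmatrix distinct_map)

lemma inj_on_eigenfunctions: "inj_on g (set xs)"
  using inj_on_state_vec_eigenfunctions by (auto simp: inj_on_def)

lemma function_basis_eigenfunctions: "function_basis xs (g ` set xs)"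
proof -
  interpret vec_space "TYPE(real)" "length xs" .
  have eq: "set (cols eigenmatrix) = state_vec xs ` g ` set xs"
    by (simp add: cols_eigenmatrix image_image)
  have "basis (set (cols eigenmatrix))"
  proof (rule dim_li_is_basis)
    show "lin_indpt (set (cols eigenmatrix))"
      using lin_dep_cols_imp_det_0[OF eigenmatrix_carrier] det_eigenmatrix by blast
    show "set (cols eigenmatrix) \<subseteq> carrier_vec (length xs)"
      using cols_dim[of eigenmatrix] by (simp add: eigenmatrix_def)
    show "dim \<le> card (set (cols eigenmatrix))"
      using distinct_card[OF distinct_cols_eigenmatrix] by (simp add: dim_is_n eigenmatrix_def)
  qed (auto simp: fin_dim)
  then show ?thesis
    using inj_on_state_vec_eigenfunctions unfolding function_basis_def eq
    by (auto simp: inj_on_def)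
qed

section \<open>Diagonalization, multiplicities and spectrum\<close>

lemma jordan_nf_transition_matrix:
  "jordan_nf (transition_matrix xs K) (map (Pair 1) (map d xs))"
proof -
  let ?n = "length xs" and ?A = "transition_matrix xs K" and ?P = eigenmatrix
  let ?D = "mat ?n ?n (\<lambda>(i, j). if i = j then d (xs ! i) else 0)"
  have A: "?A \<in> carrier_mat ?n ?n" by (simp add: transition_matrix_def)
  have D: "?D \<in> carrier_mat ?n ?n" by simp
  \<comment> \<open>The eigenfunction equations, read column by column.\<close>
  have AP: "?A * ?P = ?P * ?D"
  proof (intro eq_matI)
    fix i j assume ij: "i < dim_row (?P * ?D)" "j < dim_col (?P * ?D)"
    then have ij': "i < ?n" "j < ?n" by (auto simp: eigenmatrix_def)
    have "(?A * ?P) $$ (i, j) = (\<Sum>k<?n. pmf (K (xs ! i)) (xs ! k) * g (xs ! j) (xs ! k))"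
      using ij' by (auto simp: transition_matrix_def eigenmatrix_def scalar_prod_def lessThan_atLeast0
          intro!: sum.cong)
    also have "\<dots> = (\<Sum>y\<in>set xs. pmf (K (xs ! i)) y * g (xs ! j) y)"
      by (intro sum.reindex_bij_betw bij_betw_nth distinct_states) auto
    also have "\<dots> = d (xs ! j) * g (xs ! j) (xs ! i)" using ij' by (intro eigen) auto
    also have "\<dots> = (\<Sum>k<?n. g (xs ! k) (xs ! i) * (if k = j then d (xs ! k) else 0))"
      using ij' by (simp add: if_distrib sum.delta cong: if_cong)
    also have "\<dots> = (?P * ?D) $$ (i, j)"
      using ij' by (auto simp: eigenmatrix_def scalar_prod_def lessThan_atLeast0 intro!: sum.cong)
    finally show "(?A * ?P) $$ (i, j) = (?P * ?D) $$ (i, j)" .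
  qed (auto simp: transition_matrix_def eigenmatrix_def)
  obtain Q where Q: "Q \<in> carrier_mat ?n ?n" "?P * Q = 1\<^sub>m ?n" "Q * ?P = 1\<^sub>m ?n"
    using det_non_zero_imp_unit[OF eigenmatrix_carrier det_eigenmatrix, of "()"]
    by (auto simp: Units_def ring_mat_def)
  have "?A = ?A * (?P * Q)" using A Q by simp
  also have "\<dots> = ?A * ?P * Q" using A Q by (simp add: assoc_mult_mat[OF A eigenmatrix_carrier Q(1)])
  finally have "?A = ?P * ?D * Q" unfolding AP .
  then have "similar_mat_wit ?A ?D ?P Q"
    using A D Q by (intro similar_mat_witI[where n = ?n]) auto
  moreover have "jordan_matrix (map (Pair 1) (map d xs)) = ?D"
    by (subst jordan_matrix_singleton_blocks) (auto intro!: eq_matI)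
  ultimately show ?thesis by (auto simp: jordan_nf_def similar_mat_def)
qed

text \<open>Algebraic multiplicity adds up the sizes of the blocks for \<open>\<beta>\<close>,
  geometric multiplicity counts these blocks; size 1 makes the two agree.\<close>

lemma has_multiplicity_transition_matrix:
  "has_multiplicity (transition_matrix xs K) \<beta> (card {t \<in> set xs. d t = \<beta>})"
proof -
  let ?A = "transition_matrix xs K"
  have A: "?A \<in> carrier_mat (length xs) (length xs)" by (simp add: transition_matrix_def)
  have count: "length (filter (\<lambda>t. d t = \<beta>) xs) = card {t \<in> set xs. d t = \<beta>}"
    using distinct_states by (metis distinct_card distinct_filter set_filter)
  have "sum_list (map fst (filter (\<lambda>na. snd na = \<beta>) (map (Pair (1::nat)) (map d ys)))) =
      length (filter (\<lambda>t. d t = \<beta>) ys)" for ys :: "'s list"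
    by (induction ys) auto
  then have "algebraic_multiplicity ?A \<beta> = card {t \<in> set xs. d t = \<beta>}"
    unfolding algebraic_multiplicity_def jordan_nf_order[OF jordan_nf_transition_matrix]
    using count by simp
  \<comment> \<open>The eigenspace is the generalized eigenspace of order 1, to which a block of
    size \<open>n\<close> contributes \<open>min 1 n\<close>.\<close>
  moreover have "(\<Sum>n\<leftarrow>map fst (filter (\<lambda>(n, e). e = \<beta>) (map (Pair (1::nat)) (map d ys))). min 1 n) =
      length (filter (\<lambda>t. d t = \<beta>) ys)" for ys :: "'s list"
    by (induction ys) auto
  then have "dim_gen_eigenspace ?A \<beta> 1 = card {t \<in> set xs. d t = \<beta>}"
    unfolding dim_gen_eigenspace[OF jordan_nf_transition_matrix] using count by simp
  then have "geometric_multiplicity ?A \<beta> = card {t \<in> set xs. d t = \<beta>}"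
    using A char_matrix_closed[OF A, of \<beta>]
    by (simp add: geometric_multiplicity_def dim_gen_eigenspace_def)
  ultimately show ?thesis by (simp add: has_multiplicity_def)
qed

text \<open>The spectrum is taken over the complex numbers to exclude nonreal eigenvalues too: the
  characteristic polynomial already splits over the reals.\<close>

lemma spectrum_transition_matrix:
  "spectrum (map_mat complex_of_real (transition_matrix xs K)) = complex_of_real ` d ` set xs"
proof -
  let ?A = "transition_matrix xs K"
  interpret of_real_poly: map_poly_comm_ring_hom complex_of_real ..
  have A: "?A \<in> carrier_mat (length xs) (length xs)" by (simp add: transition_matrix_def)
  have "char_poly ?A = (\<Prod>t\<leftarrow>xs. [:- d t, 1:])"
    unfolding jordan_nf_char_poly[OF jordan_nf_transition_matrix] by (simp add: comp_def)
  then have "char_poly (map_mat complex_of_real ?A) =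
      map_poly complex_of_real (\<Prod>t\<leftarrow>xs. [:- d t, 1:])"
    by (simp add: of_real_hom.char_poly_hom[OF A])
  also have "\<dots> = (\<Prod>t\<leftarrow>xs. [:- complex_of_real (d t), 1:])"
    by (simp add: of_real_poly.hom_prod_list comp_def)
  finally have cp: "char_poly (map_mat complex_of_real ?A) = \<dots>" .
  have "poly (\<Prod>t\<leftarrow>ys. [:- complex_of_real (d t), 1:]) k = 0 \<longleftrightarrow>
      k \<in> complex_of_real ` d ` set ys" for k and ys :: "'s list"
    by (induction ys) auto
  with A show ?thesis by (subst spectrum_root_char_poly[of _ "length xs"]) (auto simp: cp)
qed

end

section \<open>Random lists and random subsets\<close>

text \<open>A uniform element is an ordered draw of \<open>m\<close> elements without replacement, a
  form that can be split after the first draw.\<close>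

definition distinct_lists :: "nat \<Rightarrow> 'a set \<Rightarrow> 'a list set" where
  "distinct_lists m B = {es. length es = m \<and> distinct es \<and> set es \<subseteq> B}"

lemma finite_distinct_lists: "finite B \<Longrightarrow> finite (distinct_lists m B)"
  by (rule finite_subset[OF _ finite_lists_length_eq[of B m]]) (auto simp: distinct_lists_def)

lemma distinct_lists_nonempty:
  assumes "finite B" "m \<le> card B"
  shows "distinct_lists m B \<noteq> {}"
proof -
  obtain A where "A \<subseteq> B" "card A = m" using assms(2) by (meson obtain_subset_with_card_n)
  moreover obtain es where "set es = A" "distinct es"
    using finite_distinct_list finite_subset[OF \<open>A \<subseteq> B\<close> assms(1)] by blast
  ultimately show ?thesis using distinct_card[of es] by (auto simp: distinct_lists_def)
qed

text \<open>The first entry partitions the lists into classes of equal size, so it is uniform and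
  the rest is uniform given it.\<close>

lemma pmf_of_set_distinct_lists_Suc:
  assumes "finite B" "Suc m \<le> card B"
  shows "pmf_of_set (distinct_lists (Suc m) B) =
    bind_pmf (pmf_of_set B) (\<lambda>e. map_pmf ((#) e) (pmf_of_set (distinct_lists m (B - {e}))))"
proof -
  let ?f = "\<lambda>e. (#) e ` distinct_lists m (B - {e})"
  have eq: "distinct_lists (Suc m) B = (\<Union>e\<in>B. ?f e)"
    by (auto simp: distinct_lists_def length_Suc_conv image_iff)
  have fin: "finite (distinct_lists m (B - {e}))" for e
    using assms(1) by (intro finite_distinct_lists) auto
  have ne: "distinct_lists m (B - {e}) \<noteq> {}" if "e \<in> B" for e
    using assms that by (intro distinct_lists_nonempty) auto
  have "pmf_of_set (\<Union>e\<in>B. ?f e) = bind_pmf (pmf_of_set B) (\<lambda>e. pmf_of_set (?f e))"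
  proof (rule pmf_of_set_UN)
    show "finite (\<Union>e\<in>B. ?f e)" using assms(1) fin by auto
    show "B \<noteq> {}" using assms by auto
    show "?f e \<noteq> {}" if "e \<in> B" for e using ne[OF that] by simp
    \<comment> \<open>A falling factorial with \<open>m\<close> factors, the same for every
      \<open>e\<close>.\<close>
    show "card (?f e) = \<Prod>{card B - 1 - m + 1..card B - 1}" if "e \<in> B" for e
      using assms that card_lists_distinct_length_eq[of "B - {e}" m]
      by (simp add: card_image distinct_lists_def)
    show "disjoint_family_on ?f B" by (auto simp: disjoint_family_on_def)
  qed
  also have "\<dots> = bind_pmf (pmf_of_set B) (\<lambda>e. map_pmf ((#) e) (pmf_of_set (distinct_lists m (B - {e}))))"
  proof (intro bind_pmf_cong refl map_pmf_of_set_inj[symmetric])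
    fix e assume "e \<in> set_pmf (pmf_of_set B)"
    moreover have "B \<noteq> {}" using assms by auto
    ultimately show "distinct_lists m (B - {e}) \<noteq> {}" using assms ne by simp
  qed (use fin in auto)
  finally show ?thesis unfolding eq .
qed

text \<open>Every subset of size \<open>m\<close> is the entry set of exactly \<open>fact m\<close>
  lists. This links ordered draws to the definition of \<open>fire_uniform\<close>.\<close>

lemma pmf_of_set_distinct_lists_conv_permutations:
  assumes "finite B" "m \<le> card B"
  shows "pmf_of_set (distinct_lists m B) =
    bind_pmf (pmf_of_set {A. A \<subseteq> B \<and> card A = m}) (\<lambda>A. pmf_of_set (permutations_of_set A))"
proof -
  have fin: "finite A" if "A \<subseteq> B" for A using assms(1) that finite_subset by blast
  have eq: "distinct_lists m B = (\<Union>A\<in>{A. A \<subseteq> B \<and> card A = m}. permutations_of_set A)"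
    by (auto simp: distinct_lists_def permutations_of_set_def distinct_card)
  obtain A where A: "A \<subseteq> B" "card A = m" using assms(2) by (meson obtain_subset_with_card_n)
  show ?thesis unfolding eq
  proof (rule pmf_of_set_UN)
    show "finite (\<Union>A\<in>{A. A \<subseteq> B \<and> card A = m}. permutations_of_set A)"
      using finite_distinct_lists[OF assms(1), of m] eq by simp
    show "{A. A \<subseteq> B \<and> card A = m} \<noteq> {}" using A by blast
    show "permutations_of_set A \<noteq> {}" if "A \<in> {A. A \<subseteq> B \<and> card A = m}" for A
      using that fin by auto
    show "card (permutations_of_set A) = fact m" if "A \<in> {A. A \<subseteq> B \<and> card A = m}" for A
      using that fin by auto
    show "disjoint_family_on permutations_of_set {A. A \<subseteq> B \<and> card A = m}"
      by (auto simp: disjoint_family_on_def permutations_of_set_def)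
  qed
qed

lemma pmf_bind_Pi_bernoulli_subset:
  assumes "finite A" "0 \<le> p" "p \<le> 1"
  shows "pmf (bind_pmf (Pi_pmf A False (\<lambda>_. bernoulli_pmf p)) (\<lambda>b. h {e \<in> A. b e})) y =
    (\<Sum>B\<in>Pow A. p ^ card B * (1 - p) ^ (card A - card B) * pmf (h B) y)"
proof -
  let ?M = "Pi_pmf A False (\<lambda>_. bernoulli_pmf p)"
  have "pmf (bind_pmf ?M (\<lambda>b. h {e \<in> A. b e})) y = (\<integral>b. pmf (h {e \<in> A. b e}) y \<partial>measure_pmf ?M)"
    by (rule pmf_bind)
  \<comment> \<open>Outside \<open>A\<close> the random function has the default value
    \<open>False\<close>, so it is almost surely the indicator of a subset of \<open>A\<close> and
    the integral is a finite sum.\<close>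
  also have "\<dots> = (\<Sum>b\<in>(\<lambda>B x. x \<in> B) ` Pow A. pmf (h {e \<in> A. b e}) y * pmf ?M b)"
  proof (rule integral_measure_pmf_real)
    fix b assume "b \<in> set_pmf ?M"
    then have "\<forall>x. x \<notin> A \<longrightarrow> b x = False" 
      using set_Pi_pmf_subset[OF assms(1), of False "\<lambda>_. bernoulli_pmf p"] by auto
    then have "b = (\<lambda>x. x \<in> {e \<in> A. b e})" by auto
    then show "b \<in> (\<lambda>B x. x \<in> B) ` Pow A" by blast
  qed (use assms in auto)
  also have "\<dots> = (\<Sum>B\<in>Pow A. pmf (h {e \<in> A. e \<in> B}) y * pmf ?M (\<lambda>x. x \<in> B))"
    by (subst sum.reindex) (auto simp: inj_on_def fun_eq_iff)
  also have "\<dots> = (\<Sum>B\<in>Pow A. p ^ card B * (1 - p) ^ (card A - card B) * pmf (h B) y)"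
  proof (rule sum.cong)
    fix B assume "B \<in> Pow A"
    then have B: "B \<subseteq> A" "finite B" using assms(1) finite_subset by auto
    have "pmf ?M (\<lambda>x. x \<in> B) = (\<Prod>x\<in>A. pmf (bernoulli_pmf p) (x \<in> B))"
      using B assms by (subst pmf_Pi') auto
    also have "\<dots> = (\<Prod>x\<in>B. pmf (bernoulli_pmf p) (x \<in> B)) * (\<Prod>x\<in>A - B. pmf (bernoulli_pmf p) (x \<in> B))"
      using B assms by (metis prod.subset_diff mult.commute)
    also have "\<dots> = (\<Prod>x\<in>B. p) * (\<Prod>x\<in>A - B. 1 - p)"
      using assms by (intro arg_cong2[where f = "(*)"] prod.cong) auto
    also have "\<dots> = p ^ card B * (1 - p) ^ (card A - card B)"
      using B assms by (simp add: card_Diff_subset)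
    moreover have "{e \<in> A. e \<in> B} = B" using B by auto
    ultimately show "pmf (h {e \<in> A. e \<in> B}) y * pmf ?M (\<lambda>x. x \<in> B) =
        p ^ card B * (1 - p) ^ (card A - card B) * pmf (h B) y" by simp
  qed simp
  finally show ?thesis .
qed

section \<open>Rooted subtrees and cascades\<close>

context rooted_tree
begin

lemma connected_imp_directed_path:
  assumes "S \<in> rooted_subtrees" "v \<in> S"
  shows "(r, v) \<in> (E \<inter> S \<times> S)\<^sup>*"
proof -
  have "(r, v) \<in> ((E \<union> E\<inverse>) \<inter> S \<times> S)\<^sup>*"
    using assms by (auto simp: rooted_subtrees_def connected_vertices_def)
  then show ?thesis
  proof (induction rule: rtrancl_induct)
    case (step x y)
    from step.hyps(2) consider "(x, y) \<in> E \<inter> S \<times> S" | "(y, x) \<in> E" by blast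
    then show ?case
    proof cases
      case 2
      then have "x \<noteq> r" using root_no_parent by blast
      then obtain z where "(r, z) \<in> (E \<inter> S \<times> S)\<^sup>*" "(z, x) \<in> E"
        using step.IH by (metis IntD1 rtranclE)
      with 2 show ?thesis using unique_parent by blast
    next
      case 1
      with step.IH show ?thesis by (rule rtrancl_into_rtrancl)
    qed
  qed simp
qed

text \<open>A directed path from the root enters each vertex through its unique parent. Conversely,
  a path of the whole tree from the root to a vertex of a parent-closed set stays in that
  set.\<close>

lemma rooted_subtrees_iff_parent_closed:
  "S \<in> rooted_subtrees \<longleftrightarrow> S \<subseteq> V \<and> r \<in> S \<and> (\<forall>u w. (u, w) \<in> E \<longrightarrow> w \<in> S \<longrightarrow> u \<in> S)"
proof
  assume S: "S \<in> rooted_subtrees"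
  have "u \<in> S" if "(u, w) \<in> E" "w \<in> S" for u w
  proof -
    have "w \<noteq> r" using that root_no_parent by blast
    then obtain z where "(z, w) \<in> E \<inter> S \<times> S"
      using connected_imp_directed_path[OF S \<open>w \<in> S\<close>] by (metis rtranclE)
    then show ?thesis using that unique_parent by blast
  qed
  then show "S \<subseteq> V \<and> r \<in> S \<and> (\<forall>u w. (u, w) \<in> E \<longrightarrow> w \<in> S \<longrightarrow> u \<in> S)"
    using S by (auto simp: rooted_subtrees_def)
next
  assume S: "S \<subseteq> V \<and> r \<in> S \<and> (\<forall>u w. (u, w) \<in> E \<longrightarrow> w \<in> S \<longrightarrow> u \<in> S)"
  let ?R = "(E \<union> E\<inverse>) \<inter> S \<times> S"
  have path: "(r, v) \<in> ?R\<^sup>*" if "v \<in> S" for v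
  proof -
    have "(r, v) \<in> E\<^sup>*" using S that reachable by blast
    then have "v \<in> S \<longrightarrow> (r, v) \<in> ?R\<^sup>*"
    proof (induction rule: rtrancl_induct)
      case (step y z)
      show ?case
      proof
        assume "z \<in> S"
        moreover from this have "y \<in> S" using S step.hyps by blast
        ultimately have "(r, y) \<in> ?R\<^sup>*" "(y, z) \<in> ?R" using step by auto
        then show "(r, z) \<in> ?R\<^sup>*" by (rule rtrancl_into_rtrancl)
      qed
    qed simp
    with that show ?thesis by blast
  qed
  have "sym ?R" by (auto simp: sym_def)
  then have "sym (?R\<^sup>*)" by (rule sym_rtrancl)
  then have "(u, v) \<in> ?R\<^sup>*" if "u \<in> S" "v \<in> S" for u v
    using path[OF that(1)] path[OF that(2)] by (meson rtrancl_trans symD)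
  then show "S \<in> rooted_subtrees" using S by (auto simp: rooted_subtrees_def connected_vertices_def)
qed

lemma finite_rooted_subtrees: "finite rooted_subtrees"
  by (rule finite_subset[of _ "Pow V"]) (auto simp: rooted_subtrees_def finite_vertices)

lemma rooted_subtrees_finite: "T \<in> rooted_subtrees \<Longrightarrow> finite T"
  using finite_vertices finite_subset by (auto simp: rooted_subtrees_def)

lemma root_in_rooted_subtrees: "T \<in> rooted_subtrees \<Longrightarrow> r \<in> T"
  by (simp add: rooted_subtrees_def)

lemma whole_tree_in_rooted_subtrees: "V \<in> rooted_subtrees"
  using root_in edges_in by (auto simp: rooted_subtrees_iff_parent_closed)

lemma root_only_in_rooted_subtrees: "{r} \<in> rooted_subtrees"
  using root_in root_no_parent by (auto simp: rooted_subtrees_iff_parent_closed)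

lemma card_rooted_subtree_pos: "T \<in> rooted_subtrees \<Longrightarrow> 0 < card T"
  using rooted_subtrees_finite root_in_rooted_subtrees by (auto simp: card_gt_0_iff)

lemma card_rooted_subtree_eq_1_iff: "T \<in> rooted_subtrees \<Longrightarrow> card T = 1 \<longleftrightarrow> T = {r}"
  using root_in_rooted_subtrees by (auto simp: card_1_singleton_iff)

text \<open>The root has a child as long as another vertex remains, so it survives; removing a
  childless vertex deprives no vertex of its parent.\<close>

lemma rooted_subtree_delete_leaf:
  assumes "T \<in> rooted_subtrees" "T \<noteq> {r}" "children T u = {}"
  shows "T - {u} \<in> rooted_subtrees"
proof -
  obtain v where "v \<in> T" "v \<noteq> r" using assms(1,2) root_in_rooted_subtrees by blast
  then have "children T r \<noteq> {}"
    using connected_imp_directed_path[OF assms(1), of v] unfolding children_def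
    by (metis (mono_tags, lifting) converse_rtranclE empty_iff mem_Collect_eq)
  with assms show ?thesis
    by (auto simp: rooted_subtrees_iff_parent_closed children_def)
qed

section \<open>Promotion cascades\<close>

lemma strict_descendants_subset: "strict_descendants T u \<subseteq> T - {u}"
proof
  fix w assume "w \<in> strict_descendants T u"
  then have p: "(u, w) \<in> (E \<inter> T \<times> T)\<^sup>+" by (simp add: strict_descendants_def)
  then have "(u, w) \<in> E\<^sup>+" by (rule trancl_mono) auto
  then have "w \<noteq> u" using acyclic_edges by blast
  moreover from p have "w \<in> T" by (meson IntD2 mem_Sigma_iff tranclE)
  ultimately show "w \<in> T - {u}" by blast
qed

text \<open>The employee at the vacated vertex \<^term>\<open>u\<close> is no longer part of the company, hence the
  hypotheses on \<^term>\<open>\<sigma>\<close> disregard \<^term>\<open>u\<close>; this is what makes them an invariant of the cascade.\<close>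

lemma set_pmf_cascade:
  assumes "c \<in> set_pmf (cascade T \<sigma> u)" "T \<in> rooted_subtrees" "T \<noteq> {r}" "u \<in> T" "inj_on \<sigma> (T - {u})"
  shows "fst c \<in> rooted_subtrees \<and> Suc (card (fst c)) = card T \<and>
    inj_on (snd c) (fst c) \<and> snd c ` fst c = \<sigma> ` (T - {u})"
  using assms
proof (induction T \<sigma> u rule: cascade.induct)
  case (1 T \<sigma> u)
  show ?case
  proof (cases "children T u = {}")
    case True
    then have "c = (T - {u}, \<sigma>)" using 1(2) by (subst (asm) cascade.simps) simp
    moreover have "Suc (card (T - {u})) = card T"
      using 1(3,5) rooted_subtrees_finite by (intro card_Suc_Diff1)
    ultimately show ?thesis using 1(3-) True rooted_subtree_delete_leaf by simp
  next
    case False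
    then have set: "set_pmf (pmf_of_set (strict_descendants T u)) = strict_descendants T u"
      by (simp add: finite_strict_descendants strict_descendants_nonempty)
    from 1(2) False obtain w where w: "w \<in> strict_descendants T u"
      "c \<in> set_pmf (cascade T (\<sigma>(u := \<sigma> w)) w)"
      by (subst (asm) cascade.simps) (auto simp: set)
    then have wT: "w \<in> T" "w \<noteq> u" using strict_descendants_subset by auto
    \<comment> \<open>The employee \<open>\<sigma> w\<close> now sits at \<open>u\<close> and
      \<open>w\<close> is the vacated vertex, so the company consists of the same people.\<close>
    have "inj_on (\<sigma>(u := \<sigma> w)) (T - {w})"
      using 1(6) wT by (auto simp: inj_on_def)
    moreover have "(\<sigma>(u := \<sigma> w)) ` (T - {w}) = \<sigma> ` (T - {u})"
      using wT 1(5) by (auto simp: image_iff)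
    ultimately show ?thesis
      using 1(1)[OF False _ w(2) 1(3,4) wT(1)] w(1) unfolding set by metis
  qed
qed

text \<open>The random choices concern vertices only, so the names of the employees do not influence
  the remaining tree.\<close>

lemma map_fst_cascade_cong:
  fixes \<sigma> :: "'v \<Rightarrow> 'e" and \<tau> :: "'v \<Rightarrow> 'f"
  shows "map_pmf fst (cascade T \<sigma> u) = map_pmf fst (cascade T \<tau> u)"
proof (induction T \<sigma> u arbitrary: \<tau> rule: cascade.induct)
  case (1 T \<sigma> u)
  show ?case
  proof (cases "children T u = {}")
    case True
    then show ?thesis by (subst (1 2) cascade.simps) simp
  next
    case False
    then show ?thesis
      by (subst (1 2) cascade.simps) (auto simp: map_bind_pmf intro!: bind_pmf_cong 1)
  qed
qed

lemma the_position:
  assumes "inj_on \<sigma> T" "v \<in> T"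
  shows "(THE x. x \<in> T \<and> \<sigma> x = \<sigma> v) = v"
  using assms by (auto simp: inj_on_def)

section \<open>Firing uniformly chosen employees\<close>

definition fire_one :: "'v set \<Rightarrow> 'v set pmf" where
  "fire_one T = bind_pmf (pmf_of_set T) (\<lambda>e. map_pmf fst (fire e (T, id)))"

text \<open>In contrast to \<open>fire_list\<close>, the names restart as \<open>id\<close> at each
  step, so this is a power of the Markov kernel \<open>fire_one\<close>.\<close>

primrec fire_iter :: "nat \<Rightarrow> 'v set \<Rightarrow> 'v set pmf" where
  "fire_iter 0 T = return_pmf T"
| "fire_iter (Suc m) T = bind_pmf (fire_one T) (fire_iter m)"

lemma fire_iter_add: "fire_iter (m + k) T = bind_pmf (fire_iter m T) (fire_iter k)"
  by (induction m arbitrary: T)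
    (auto simp: bind_return_pmf bind_assoc_pmf intro!: bind_pmf_cong)

text \<open>Under an injective occupation a uniform employee sits at a uniform vertex, and the
  resulting tree does not depend on the naming.\<close>

lemma fire_one_conv_fire:
  assumes "T \<in> rooted_subtrees" "inj_on \<sigma> T"
  shows "fire_one T = bind_pmf (pmf_of_set (\<sigma> ` T)) (\<lambda>e. map_pmf fst (fire e (T, \<sigma>)))"
proof -
  have T: "finite T" "T \<noteq> {}"
    using assms rooted_subtrees_finite root_in_rooted_subtrees by auto
  have "pmf_of_set (\<sigma> ` T) = map_pmf \<sigma> (pmf_of_set T)"
    using assms T by (simp add: map_pmf_of_set_inj)
  then have "bind_pmf (pmf_of_set (\<sigma> ` T)) (\<lambda>e. map_pmf fst (fire e (T, \<sigma>))) =
      bind_pmf (pmf_of_set T) (\<lambda>v. map_pmf fst (fire (\<sigma> v) (T, \<sigma>)))"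
    by (simp add: bind_map_pmf)
  also have "\<dots> = fire_one T" unfolding fire_one_def
  proof (intro bind_pmf_cong refl)
    fix v assume "v \<in> set_pmf (pmf_of_set T)"
    then have "v \<in> T" using T by simp
    then show "map_pmf fst (fire (\<sigma> v) (T, \<sigma>)) = map_pmf fst (fire v (T, id))"
      using the_position[OF assms(2)] the_position[of id T v] map_fst_cascade_cong[of T \<sigma> v id]
      by (simp add: fire_def)
  qed
  finally show ?thesis ..
qed

lemma set_pmf_fire:
  assumes "c \<in> set_pmf (fire e (T, \<sigma>))" "T \<in> rooted_subtrees" "T \<noteq> {r}" "inj_on \<sigma> T" "e \<in> \<sigma> ` T"
  shows "fst c \<in> rooted_subtrees" "Suc (card (fst c)) = card T"
    "inj_on (snd c) (fst c)" "snd c ` fst c = \<sigma> ` T - {e}"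
proof -
  obtain v where v: "v \<in> T" "e = \<sigma> v" using assms(5) by blast
  then have "c \<in> set_pmf (cascade T \<sigma> v)"
    using assms(1,3) the_position[OF assms(4) v(1)] by (simp add: fire_def)
  moreover have "inj_on \<sigma> (T - {v})" using assms(4) by (rule inj_on_diff)
  moreover have "\<sigma> ` (T - {v}) = \<sigma> ` T - {e}" using assms(4) v by (auto simp: inj_on_def)
  ultimately show "fst c \<in> rooted_subtrees" "Suc (card (fst c)) = card T"
    "inj_on (snd c) (fst c)" "snd c ` fst c = \<sigma> ` T - {e}"
    using set_pmf_cascade[of c T \<sigma> v] assms(2,3) v(1) by auto
qed

lemma fire_one_root: "fire_one {r} = return_pmf {r}"
  by (simp add: fire_one_def fire_def)

lemma set_pmf_fire_one:
  assumes "T \<in> rooted_subtrees" "T \<noteq> {r}" "y \<in> set_pmf (fire_one T)"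
  shows "y \<in> rooted_subtrees" "Suc (card y) = card T"
proof -
  have "finite T" "T \<noteq> {}" using assms rooted_subtrees_finite root_in_rooted_subtrees by auto
  then obtain e c where "e \<in> T" "c \<in> set_pmf (fire e (T, id))" "y = fst c"
    using assms(3) by (auto simp: fire_one_def)
  then show "y \<in> rooted_subtrees" "Suc (card y) = card T"
    using set_pmf_fire[of c e T id] assms(1,2) by auto
qed

text \<open>Each step removes one vertex until only the root is left, where the chain stops; hence
  the floor 1.\<close>

lemma set_pmf_fire_iter:
  assumes "T \<in> rooted_subtrees" "y \<in> set_pmf (fire_iter m T)"
  shows "y \<in> rooted_subtrees \<and> card y = max 1 (card T - m)"
  using assms
proof (induction m arbitrary: T)
  case 0
  then show ?case using card_rooted_subtree_pos[of T] by auto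
next
  case (Suc m)
  show ?case
  proof (cases "T = {r}")
    case True
    then show ?thesis using Suc by (auto simp: fire_one_root bind_return_pmf)
  next
    case False
    from Suc.prems obtain z where z: "z \<in> set_pmf (fire_one T)" "y \<in> set_pmf (fire_iter m z)"
      by auto
    then show ?thesis using Suc.IH[of z] set_pmf_fire_one[OF Suc.prems(1) False z(1)] by auto
  qed
qed

text \<open>Given the outcome of the first firing, the next employee to be fired is uniform among the
  remaining ones, so the exchangeable random list turns into independent uniform firings.\<close>

lemma fire_list_distinct_lists_eq_fire_iter:
  assumes "T \<in> rooted_subtrees" "inj_on \<sigma> T" "m \<le> card T"
  shows "bind_pmf (pmf_of_set (distinct_lists m (\<sigma> ` T)))
      (\<lambda>es. map_pmf fst (fire_list es (T, \<sigma>))) = fire_iter m T"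
  using assms
proof (induction m arbitrary: T \<sigma>)
  case 0
  have "distinct_lists 0 (\<sigma> ` T) = {[]}" by (auto simp: distinct_lists_def)
  then show ?case by (simp add: pmf_of_set_singleton bind_return_pmf)
next
  case (Suc m)
  have T: "finite T" "T \<noteq> {}"
    using Suc.prems rooted_subtrees_finite root_in_rooted_subtrees by auto
  have card: "card (\<sigma> ` T) = card T" using Suc.prems(2) by (rule card_image)
  have "bind_pmf (pmf_of_set (distinct_lists (Suc m) (\<sigma> ` T)))
      (\<lambda>es. map_pmf fst (fire_list es (T, \<sigma>))) =
    bind_pmf (pmf_of_set (\<sigma> ` T)) (\<lambda>e. bind_pmf (pmf_of_set (distinct_lists m (\<sigma> ` T - {e})))
      (\<lambda>es. bind_pmf (fire e (T, \<sigma>)) (\<lambda>c. map_pmf fst (fire_list es c))))"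
    using T card Suc.prems(3)
    by (simp add: pmf_of_set_distinct_lists_Suc bind_assoc_pmf bind_map_pmf map_bind_pmf)
  \<comment> \<open>The remaining draws are independent of the cascade, so the cascade may be run
    first.\<close>
  also have "\<dots> = bind_pmf (pmf_of_set (\<sigma> ` T)) (\<lambda>e. bind_pmf (fire e (T, \<sigma>))
      (\<lambda>c. bind_pmf (pmf_of_set (distinct_lists m (\<sigma> ` T - {e})))
        (\<lambda>es. map_pmf fst (fire_list es c))))"
    by (subst bind_commute_pmf) simp
  also have "\<dots> = bind_pmf (pmf_of_set (\<sigma> ` T)) (\<lambda>e. bind_pmf (fire e (T, \<sigma>))
      (\<lambda>c. fire_iter m (fst c)))"
  proof (intro bind_pmf_cong refl)
    fix e c assume "e \<in> set_pmf (pmf_of_set (\<sigma> ` T))" and c: "c \<in> set_pmf (fire e (T, \<sigma>))"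
    then have e: "e \<in> \<sigma> ` T" using T by simp
    show "bind_pmf (pmf_of_set (distinct_lists m (\<sigma> ` T - {e})))
        (\<lambda>es. map_pmf fst (fire_list es c)) = fire_iter m (fst c)"
    proof (cases "T = {r}")
      \<comment> \<open>The boss is not removed here, so the induction hypothesis does not fit; but
        \<open>Suc m \<le> card T\<close> forces \<open>m = 0\<close>.\<close>
      case True
      then have "c = (T, \<sigma>)" "m = 0" using c Suc.prems(3) by (auto simp: fire_def)
      moreover have "distinct_lists 0 (\<sigma> ` T - {e}) = {[]}" by (auto simp: distinct_lists_def)
      ultimately show ?thesis by (simp add: pmf_of_set_singleton bind_return_pmf)
    next
      case False
      note c' = set_pmf_fire[OF c Suc.prems(1) False Suc.prems(2) e]
      show ?thesis using Suc.IH[OF c'(1,3)] c'(2,4) Suc.prems(3) by simp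
    qed
  qed
  also have "\<dots> = fire_iter (Suc m) T"
    by (simp add: fire_one_conv_fire[OF Suc.prems(1,2)] bind_assoc_pmf bind_map_pmf)
  finally show ?case .
qed

text \<open>Drawing a random set and then its order is an ordered draw without replacement, applied
  to the initial naming \<open>id\<close>.\<close>

lemma fire_uniform_eq_fire_iter:
  assumes "T \<in> rooted_subtrees" "m \<le> card T"
  shows "fire_uniform m T = fire_iter m T"
  using fire_list_distinct_lists_eq_fire_iter[of T id m] assms rooted_subtrees_finite[of T]
  by (simp add: fire_uniform_def fire_set_def pmf_of_set_distinct_lists_conv_permutations bind_assoc_pmf)

section \<open>Tree eigenfunctions and powers of the firing kernel\<close>

lemma tree_eigenfunction_eq:
  assumes "T \<in> rooted_subtrees"
  shows "tree_eigenfunction T' T =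
    (if card T < card T' then 0
     else real (card T choose card T') * pmf (fire_iter (card T - card T') T) T')"
  by (simp add: tree_eigenfunction_def fire_uniform_eq_fire_iter[OF assms])

lemma tree_eigenfunction_diagonal: "T \<in> rooted_subtrees \<Longrightarrow> tree_eigenfunction T T = 1"
  by (simp add: tree_eigenfunction_eq)

text \<open>At equal size no firing takes place, so \<open>T\<close> stays as it is and differs from
  \<open>T'\<close>.\<close>

lemma tree_eigenfunction_triangular:
  "T \<in> rooted_subtrees \<Longrightarrow> T \<noteq> T' \<Longrightarrow> card T \<le> card T' \<Longrightarrow> tree_eigenfunction T' T = 0"
  by (auto simp: tree_eigenfunction_eq)

text \<open>The size after \<open>m\<close> firings is deterministic, so the binomial coefficient
  factors out, and the remaining kernel powers compose to one that does not depend on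
  \<open>m\<close>.\<close>

lemma sum_pmf_fire_iter_tree_eigenfunction:
  assumes T: "T \<in> rooted_subtrees" and T': "1 < card T'" and m: "m \<le> card T"
  shows "(\<Sum>y\<in>rooted_subtrees. pmf (fire_iter m T) y * tree_eigenfunction T' y) =
    real ((card T - m) choose card T') * pmf (fire_iter (card T - card T') T) T'"
proof (cases "card T - m < card T'")
  case True
  \<comment> \<open>Every reachable \<open>y\<close> is smaller than \<open>T'\<close>:
    \<open>1 < card T'\<close> keeps even the floor 1 below \<open>card T'\<close>.\<close>
  have "pmf (fire_iter m T) y * tree_eigenfunction T' y = 0" if "y \<in> rooted_subtrees" for y
    using set_pmf_fire_iter[OF T, of y m] True T'
    by (cases "y \<in> set_pmf (fire_iter m T)")
      (auto simp: tree_eigenfunction_def pmf_eq_0_set_pmf)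
  then show ?thesis using True by (simp add: binomial_eq_0)
next
  case False
  let ?k = "card T - m - card T'"
  have "(\<Sum>y\<in>rooted_subtrees. pmf (fire_iter m T) y * tree_eigenfunction T' y) =
      (\<Sum>y\<in>rooted_subtrees. real ((card T - m) choose card T') *
        (pmf (fire_iter ?k y) T' * pmf (fire_iter m T) y))"
  proof (rule sum.cong)
    fix y assume y: "y \<in> rooted_subtrees"
    show "pmf (fire_iter m T) y * tree_eigenfunction T' y =
      real ((card T - m) choose card T') * (pmf (fire_iter ?k y) T' * pmf (fire_iter m T) y)"
    proof (cases "y \<in> set_pmf (fire_iter m T)")
      case True
      then have "card y = card T - m" using set_pmf_fire_iter[OF T] False T' by fastforce
      then show ?thesis using False by (simp add: tree_eigenfunction_eq[OF y])
    qed (simp add: pmf_eq_0_set_pmf)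
  qed simp
  also have "\<dots> = real ((card T - m) choose card T') * pmf (bind_pmf (fire_iter m T) (fire_iter ?k)) T'"
    unfolding pmf_bind using set_pmf_fire_iter[OF T]
    by (subst integral_measure_pmf_real[OF finite_rooted_subtrees]) (auto simp: sum_distrib_left)
  also have "bind_pmf (fire_iter m T) (fire_iter ?k) = fire_iter (card T - card T') T"
    using False m by (simp flip: fire_iter_add)
  finally show ?thesis .
qed

section \<open>The two models as mixtures of powers of the firing kernel\<close>

lemma card_le_card_vertices: "T \<in> rooted_subtrees \<Longrightarrow> card T \<le> card V"
  using finite_vertices by (auto simp: rooted_subtrees_def intro: card_mono)

lemma pmf_single_model:
  assumes "T \<in> rooted_subtrees"
  shows "pmf (single_model T) y =
    real (card T) / real (card V) * pmf (fire_iter 1 T) y +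
    (1 - real (card T) / real (card V)) * pmf (fire_iter 0 T) y"
proof -
  have "0 \<le> real (card T) / real (card V)" "real (card T) / real (card V) \<le> 1"
    using card_le_card_vertices[OF assms] by (auto simp: divide_le_eq)
  moreover have "fire_iter 1 T = fire_one T"
    using bind_return_pmf'[of "fire_one T"] by (simp cong: bind_pmf_cong)
  ultimately show ?thesis
    by (simp add: single_model_def pmf_bind[of "bernoulli_pmf _"] del: fire_iter.simps(2) flip: fire_one_def)
qed

text \<open>The number of fired employees is binomial, and given this number \<open>m\<close> the
  fired set is uniform among the subsets of size \<open>m\<close>.\<close>

lemma pmf_binomial_model:
  assumes "T \<in> rooted_subtrees" "0 \<le> q" "q \<le> 1"
  shows "pmf (binomial_model q T) y =
    (\<Sum>m\<le>card T. real (card T choose m) * (1 - q) ^ m * q ^ (card T - m) * pmf (fire_iter m T) y)"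
proof -
  have T: "finite T" using assms rooted_subtrees_finite by simp
  have "pmf (binomial_model q T) y =
      (\<Sum>A\<in>Pow T. (1 - q) ^ card A * q ^ (card T - card A) * pmf (fire_set A T) y)"
    unfolding binomial_model_def
    using pmf_bind_Pi_bernoulli_subset[of T "1 - q" "\<lambda>A. fire_set A T" y] T assms by simp
  also have "\<dots> = (\<Sum>m\<le>card T. \<Sum>A | A \<in> Pow T \<and> card A = m.
      (1 - q) ^ card A * q ^ (card T - card A) * pmf (fire_set A T) y)"
    using T by (intro sum.group[symmetric]) (auto intro: card_mono)
  also have "\<dots> = (\<Sum>m\<le>card T. real (card T choose m) * (1 - q) ^ m * q ^ (card T - m) *
      pmf (fire_iter m T) y)"
  proof (rule sum.cong)
    fix m assume "m \<in> {..card T}"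
    then have m: "m \<le> card T" by simp
    let ?B = "{A. A \<subseteq> T \<and> card A = m}"
    have B: "finite ?B" "card ?B = card T choose m" using T by (auto simp: n_subsets)
    with m have "?B \<noteq> {}" by (metis card.empty zero_less_binomial less_irrefl)
    then have "pmf (fire_iter m T) y = (\<Sum>A\<in>?B. pmf (fire_set A T) y) / real (card T choose m)"
      using B fire_uniform_eq_fire_iter[OF assms(1) m, symmetric]
      by (simp add: fire_uniform_def pmf_bind_pmf_of_set)
    then have "(\<Sum>A\<in>?B. pmf (fire_set A T) y) = real (card T choose m) * pmf (fire_iter m T) y"
      using m by simp
    then show "(\<Sum>A | A \<in> Pow T \<and> card A = m.
        (1 - q) ^ card A * q ^ (card T - card A) * pmf (fire_set A T) y) =
      real (card T choose m) * (1 - q) ^ m * q ^ (card T - m) * pmf (fire_iter m T) y"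
      by (simp flip: sum_distrib_left)
  qed simp
  finally show ?thesis .
qed

section \<open>Eigenfunction equations for the two models\<close>

lemma single_model_tree_eigenfunction:
  assumes T: "T \<in> rooted_subtrees" and T': "1 < card T'"
  shows "(\<Sum>y\<in>rooted_subtrees. pmf (single_model T) y * tree_eigenfunction T' y) =
    (real (card V) - real (card T')) / real (card V) * tree_eigenfunction T' T"
proof -
  let ?n = "card T" and ?n' = "card T'" and ?N = "real (card V)"
  let ?p = "pmf (fire_iter (?n - ?n') T) T'"
  have n: "0 < ?n" "0 < ?N" using T card_rooted_subtree_pos whole_tree_in_rooted_subtrees by auto
  have "(\<Sum>y\<in>rooted_subtrees. pmf (single_model T) y * tree_eigenfunction T' y) =
      ?n / ?N * (\<Sum>y\<in>rooted_subtrees. pmf (fire_iter 1 T) y * tree_eigenfunction T' y) +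
      (1 - ?n / ?N) * (\<Sum>y\<in>rooted_subtrees. pmf (fire_iter 0 T) y * tree_eigenfunction T' y)"
    unfolding sum_distrib_left sum.distrib[symmetric]
    by (intro sum.cong refl) (simp only: pmf_single_model[OF T], simp add: algebra_simps)
  also have "\<dots> = ?n / ?N * (real ((?n - 1) choose ?n') * ?p) + (1 - ?n / ?N) * (real (?n choose ?n') * ?p)"
    using sum_pmf_fire_iter_tree_eigenfunction[OF T T', of 1]
      sum_pmf_fire_iter_tree_eigenfunction[OF T T', of 0] n by simp
  also have "\<dots> = (?n * real ((?n - 1) choose ?n') + (?N - ?n) * real (?n choose ?n')) / ?N * ?p"
    using n by (simp add: field_simps)
  \<comment> \<open>Absorption of the binomial coefficient. The subtraction is real, and for
    \<open>?n < ?n'\<close> both coefficients are 0.\<close>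
  also have "?n * real ((?n - 1) choose ?n') = (real ?n - real ?n') * real (?n choose ?n')"
  proof (cases "?n' \<le> ?n")
    case True
    then have "real ((?n - ?n') * (?n choose ?n')) = real (?n * ((?n - 1) choose ?n'))"
      by (simp only: binomial_absorb_comp)
    then show ?thesis using True by (simp add: of_nat_diff)
  qed (simp add: binomial_eq_0)
  also have "((real ?n - real ?n') * real (?n choose ?n') + (?N - ?n) * real (?n choose ?n')) / ?N * ?p =
      (?N - real ?n') / ?N * (real (?n choose ?n') * ?p)"
    by (simp add: algebra_simps)
  also have "real (?n choose ?n') * ?p = tree_eigenfunction T' T"
    by (simp add: tree_eigenfunction_eq[OF T] binomial_eq_0)
  finally show ?thesis .
qed

text \<open>Up to the common factor \<open>?p\<close>, the sum is the expected number of subsets of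
  size \<open>?n'\<close> among the survivors, each employee surviving with probability
  \<open>q\<close>.\<close>

lemma binomial_model_tree_eigenfunction:
  assumes T: "T \<in> rooted_subtrees" and T': "1 < card T'" and q: "0 \<le> q" "q \<le> 1"
  shows "(\<Sum>y\<in>rooted_subtrees. pmf (binomial_model q T) y * tree_eigenfunction T' y) =
    q ^ card T' * tree_eigenfunction T' T"
proof -
  let ?n = "card T" and ?n' = "card T'"
  let ?p = "pmf (fire_iter (?n - ?n') T) T'"
  let ?w = "\<lambda>m. real (?n choose m) * (1 - q) ^ m * q ^ (?n - m)"
  have "(\<Sum>y\<in>rooted_subtrees. pmf (binomial_model q T) y * tree_eigenfunction T' y) =
      (\<Sum>y\<in>rooted_subtrees. \<Sum>m\<le>?n. ?w m * (pmf (fire_iter m T) y * tree_eigenfunction T' y))"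
    by (intro sum.cong refl) (simp add: pmf_binomial_model[OF T q] sum_distrib_right mult.assoc)
  also have "\<dots> = (\<Sum>m\<le>?n. ?w m *
      (\<Sum>y\<in>rooted_subtrees. pmf (fire_iter m T) y * tree_eigenfunction T' y))"
    by (subst sum.swap) (simp add: sum_distrib_left)
  also have "\<dots> = (\<Sum>m\<le>?n. ?w m * real ((?n - m) choose ?n')) * ?p"
    unfolding sum_distrib_right
    by (intro sum.cong refl) (simp add: sum_pmf_fire_iter_tree_eigenfunction[OF T T'])
  also have "\<dots> = q ^ ?n' * tree_eigenfunction T' T"
  proof (cases "?n < ?n'")
    case True
    then show ?thesis by (simp add: tree_eigenfunction_def binomial_eq_0)
  next
    case False
    \<comment> \<open>For \<open>m > ?n - ?n'\<close> fewer than \<open>?n'\<close> employees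
      survive.\<close>
    have "(\<Sum>m\<le>?n. ?w m * real ((?n - m) choose ?n')) =
        (\<Sum>m\<le>?n - ?n'. ?w m * real ((?n - m) choose ?n'))"
      using False by (intro sum.mono_neutral_right) (auto simp: binomial_eq_0)
    also have "\<dots> = (\<Sum>m\<le>?n - ?n'. real (?n choose ?n') * q ^ ?n' *
        (real ((?n - ?n') choose m) * (1 - q) ^ m * q ^ (?n - ?n' - m)))"
    proof (rule sum.cong)
      fix m assume "m \<in> {..?n - ?n'}"
      with False have m: "m + ?n' \<le> ?n" by auto
      \<comment> \<open>Both sides count disjoint pairs of an \<open>m\<close>-subset and an
        \<open>?n'\<close>-subset; each is obtained by choosing their union first.\<close>
      then have "(?n choose m) * ((?n - m) choose ?n') = (?n choose ?n') * ((?n - ?n') choose m)"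
        using choose_mult[of m "m + ?n'" ?n] choose_mult[of ?n' "m + ?n'" ?n]
          binomial_symmetric[of m "m + ?n'"] by simp
      then have "real (?n choose m) * real ((?n - m) choose ?n') =
          real (?n choose ?n') * real ((?n - ?n') choose m)"
        by (simp flip: of_nat_mult)
      moreover have "q ^ (?n - m) = q ^ ?n' * q ^ (?n - ?n' - m)"
        using m by (simp flip: power_add)
      moreover have "?w m * real ((?n - m) choose ?n') =
          real (?n choose m) * real ((?n - m) choose ?n') * (1 - q) ^ m * q ^ (?n - m)"
        by simp
      ultimately show "?w m * real ((?n - m) choose ?n') = real (?n choose ?n') * q ^ ?n' *
          (real ((?n - ?n') choose m) * (1 - q) ^ m * q ^ (?n - ?n' - m))"
        by simp
    qed simp
    \<comment> \<open>What is left is the binomial expansion of a power of \<open>1 - q + q\<close>,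
      which is 1.\<close>
    also have "\<dots> = real (?n choose ?n') * q ^ ?n' * (1 - q + q) ^ (?n - ?n')"
      by (simp only: binomial_ring flip: sum_distrib_left)
    finally show ?thesis using False by (simp add: tree_eigenfunction_eq[OF T])
  qed
  finally show ?thesis .
qed

text \<open>The firing kernel never leaves the rooted subtrees, so no mass is lost and the constant
  function has eigenvalue 1.\<close>

lemma single_model_const:
  assumes T: "T \<in> rooted_subtrees"
  shows "(\<Sum>y\<in>rooted_subtrees. pmf (single_model T) y) = 1"
proof (rule sum_pmf_eq_1[OF finite_rooted_subtrees], rule subsetI, rule ccontr)
  fix y assume "y \<in> set_pmf (single_model T)" "y \<notin> rooted_subtrees"
  then have "pmf (fire_iter 1 T) y = 0" "pmf (fire_iter 0 T) y = 0"
    using set_pmf_fire_iter[OF T, of y] by (auto simp only: pmf_eq_0_set_pmf)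
  then show False
    using \<open>y \<in> set_pmf (single_model T)\<close> pmf_single_model[OF T, of y] by (simp add: set_pmf_iff)
qed

lemma binomial_model_const:
  assumes T: "T \<in> rooted_subtrees" and q: "0 \<le> q" "q \<le> 1"
  shows "(\<Sum>y\<in>rooted_subtrees. pmf (binomial_model q T) y) = 1"
proof (rule sum_pmf_eq_1[OF finite_rooted_subtrees], rule subsetI, rule ccontr)
  fix y assume "y \<in> set_pmf (binomial_model q T)" "y \<notin> rooted_subtrees"
  then have "pmf (fire_iter m T) y = 0" for m
    using set_pmf_fire_iter[OF T, of y] by (auto simp only: pmf_eq_0_set_pmf)
  then show False
    using \<open>y \<in> set_pmf (binomial_model q T)\<close> pmf_binomial_model[OF T q, of y]
    by (simp add: set_pmf_iff)
qed

text \<open>The chain itself supplies a witness: any outcome of \<open>card V - k\<close> firings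
  from the whole tree.\<close>

lemma rooted_subtree_of_card:
  assumes "1 \<le> k" "k \<le> card V"
  shows "\<exists>T\<in>rooted_subtrees. card T = k"
proof -
  obtain T where T: "T \<in> set_pmf (fire_iter (card V - k) V)" using set_pmf_not_empty by fast
  show ?thesis
    using set_pmf_fire_iter[OF whole_tree_in_rooted_subtrees T] assms by auto
qed

section \<open>Eigenvalues and eigenbasis\<close>

text \<open>The constant function takes the place indexed by \<open>{r}\<close>, which gives one
  function per state.\<close>

definition eigenbasis_function :: "'v set \<Rightarrow> 'v set \<Rightarrow> real" where
  "eigenbasis_function T' = (if T' = {r} then (\<lambda>_. 1) else tree_eigenfunction T')"

text \<open>Here \<^term>\<open>h j\<close> is the eigenvalue indexed by \<^term>\<open>j\<close>.\<close>

definition eigenbasis_value :: "(nat \<Rightarrow> real) \<Rightarrow> 'v set \<Rightarrow> real" where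
  "eigenbasis_value h T' = (if T' = {r} then 1 else h (card V - card T'))"

lemma card_rooted_subtree_gt_1:
  assumes "T \<in> rooted_subtrees" "T \<noteq> {r}"
  shows "1 < card T"
  using assms card_rooted_subtree_pos[of T] card_rooted_subtree_eq_1_iff[of T] by linarith

text \<open>Every size from 2 to \<open>card V\<close> occurs. Size 1 would give the index
  \<open>card V - 1\<close>, but its place is taken by the value 1, which is
  \<open>h (card V)\<close>.\<close>

lemma image_eigenbasis_value:
  assumes "2 \<le> card V" "h (card V) = 1"
  shows "eigenbasis_value h ` rooted_subtrees = {h j | j. j \<le> card V - 2 \<or> j = card V}"
proof (intro equalityI subsetI)
  fix x assume "x \<in> eigenbasis_value h ` rooted_subtrees"
  then obtain T where T: "T \<in> rooted_subtrees" "x = eigenbasis_value h T" by blast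
  show "x \<in> {h j | j. j \<le> card V - 2 \<or> j = card V}"
  proof (cases "T = {r}")
    case True
    then have "x = h (card V)" using T assms by (simp add: eigenbasis_value_def)
    then show ?thesis by blast
  next
    case False
    then have "x = h (card V - card T)" "card V - card T \<le> card V - 2"
      using T card_rooted_subtree_gt_1[of T] by (auto simp: eigenbasis_value_def)
    then show ?thesis by blast
  qed
next
  fix x assume "x \<in> {h j | j. j \<le> card V - 2 \<or> j = card V}"
  then obtain j where j: "x = h j" "j \<le> card V - 2 \<or> j = card V" by blast
  show "x \<in> eigenbasis_value h ` rooted_subtrees"
  proof (cases "j = card V")
    case True
    then have "x = eigenbasis_value h {r}" using j assms by (simp add: eigenbasis_value_def)
    then show ?thesis using root_only_in_rooted_subtrees by blast
  next
    case False
    then have "1 \<le> card V - j" using j assms by auto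
    then obtain T where T: "T \<in> rooted_subtrees" "card T = card V - j"
      using rooted_subtree_of_card[of "card V - j"] by auto
    then have "T \<noteq> {r}" using j assms False by auto
    then have "x = eigenbasis_value h T" using T j assms False by (simp add: eigenbasis_value_def)
    then show ?thesis using T by blast
  qed
qed

lemma eigenbasis_value_eq_1_iff:
  assumes "inj_on h {..card V}" "h (card V) = 1" "T \<in> rooted_subtrees"
  shows "eigenbasis_value h T = 1 \<longleftrightarrow> T = {r}"
  using assms inj_onD[OF assms(1), of "card V - card T" "card V"]
    card_rooted_subtree_pos[OF assms(3)] card_le_card_vertices[OF assms(3)]
  by (auto simp: eigenbasis_value_def)

lemma eigenbasis_value_eq_iff:
  assumes "inj_on h {..card V}" "h (card V) = 1" "T \<in> rooted_subtrees" "j \<le> card V - 2" "2 \<le> card V"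
  shows "eigenbasis_value h T = h j \<longleftrightarrow> card T = card V - j"
proof (cases "T = {r}")
  case True
  \<comment> \<open>For the root alone both sides are false: \<open>card V - j\<close> is at least
    2, and injectivity separates \<open>h j\<close> from 1.\<close>
  have "j \<le> card V" "j \<noteq> card V" using assms(4,5) by auto
  then have "h j \<noteq> 1" using assms(2) inj_onD[OF assms(1), of "card V" j] by auto
  with True assms show ?thesis by (auto simp: eigenbasis_value_def)
next
  case False
  then have "eigenbasis_value h T = h j \<longleftrightarrow> card V - card T = j"
    using assms inj_on_eq_iff[OF assms(1), of "card V - card T" j]
    by (simp add: eigenbasis_value_def)
  then show ?thesis using assms card_le_card_vertices[OF assms(3)] by auto
qed

lemma triangular_eigenfunctions_eigenbasis:
  assumes "distinct Ts" "set Ts = rooted_subtrees"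
    and const: "\<forall>T\<in>rooted_subtrees. (\<Sum>y\<in>rooted_subtrees. pmf (K T) y) = 1"
    and tree: "\<forall>T\<in>rooted_subtrees. \<forall>T'\<in>rooted_subtrees - {{r}}.
      (\<Sum>y\<in>rooted_subtrees. pmf (K T) y * tree_eigenfunction T' y) =
      h (card V - card T') * tree_eigenfunction T' T"
  shows "triangular_eigenfunctions Ts card K eigenbasis_function (eigenbasis_value h)"
proof
  fix T T' assume T: "T \<in> set Ts" and T': "T' \<in> set Ts"
  show "(\<Sum>y\<in>set Ts. pmf (K T) y * eigenbasis_function T' y) =
      eigenbasis_value h T' * eigenbasis_function T' T"
    using T T' assms(2) const tree by (auto simp: eigenbasis_function_def eigenbasis_value_def)
  assume "T \<noteq> T'" "card T \<le> card T'"
  \<comment> \<open>The constant function vanishes nowhere, but no state other than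
    \<open>{r}\<close> has size at most 1.\<close>
  moreover from this have "T' \<noteq> {r}"
    using T assms(2) card_rooted_subtree_gt_1[of T] by (cases "T = {r}") auto
  ultimately show "eigenbasis_function T' T = 0"
    using T assms(2) by (simp add: eigenbasis_function_def tree_eigenfunction_triangular)
next
  fix T assume "T \<in> set Ts"
  then show "eigenbasis_function T T \<noteq> 0"
    using assms(2) by (simp add: eigenbasis_function_def tree_eigenfunction_diagonal)
qed (fact assms(1))

text \<open>The two models enter only through conservation of mass and the eigenfunction equation,
  with an injective \<open>h\<close> giving the eigenvalue for each index.\<close>

lemma eigenstructure:
  assumes Ts: "distinct Ts" "set Ts = rooted_subtrees" and V: "2 \<le> card V"
    and h: "inj_on h {..card V}" "h (card V) = 1"
    and const: "\<forall>T\<in>rooted_subtrees. (\<Sum>y\<in>rooted_subtrees. pmf (K T) y) = 1"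
    and tree: "\<forall>T\<in>rooted_subtrees. \<forall>T'\<in>rooted_subtrees - {{r}}.
      (\<Sum>y\<in>rooted_subtrees. pmf (K T) y * tree_eigenfunction T' y) =
      h (card V - card T') * tree_eigenfunction T' T"
  shows "spectrum (map_mat complex_of_real (transition_matrix Ts K)) =
      {complex_of_real (h j) | j. j \<le> card V - 2 \<or> j = card V}"
    and "has_multiplicity (transition_matrix Ts K) 1 1"
    and "j \<le> card V - 2 \<Longrightarrow> has_multiplicity (transition_matrix Ts K) (h j)
      (card {T \<in> rooted_subtrees. card T = card V - j})"
    and "T' \<in> rooted_subtrees - {{r}} \<Longrightarrow>
      right_eigenfunction rooted_subtrees K (h (card V - card T')) (tree_eigenfunction T')"
    and "right_eigenfunction rooted_subtrees K 1 (\<lambda>_. 1)"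
    and "inj_on tree_eigenfunction (rooted_subtrees - {{r}})"
    and "function_basis Ts (insert (\<lambda>_. 1) (tree_eigenfunction ` (rooted_subtrees - {{r}})))"
proof -
  interpret triangular_eigenfunctions Ts card K eigenbasis_function "eigenbasis_value h"
    using Ts const tree by (rule triangular_eigenfunctions_eigenbasis)
  show "spectrum (map_mat complex_of_real (transition_matrix Ts K)) =
      {complex_of_real (h j) | j. j \<le> card V - 2 \<or> j = card V}"
    unfolding spectrum_transition_matrix Ts(2) image_eigenbasis_value[of h, OF V h(2)] by blast
  have "{T \<in> set Ts. eigenbasis_value h T = 1} = {{r}}"
    using eigenbasis_value_eq_1_iff[OF h] root_only_in_rooted_subtrees Ts(2) by auto
  then show "has_multiplicity (transition_matrix Ts K) 1 1"
    using has_multiplicity_transition_matrix[of 1] by simp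
  show "has_multiplicity (transition_matrix Ts K) (h j)
      (card {T \<in> rooted_subtrees. card T = card V - j})" if "j \<le> card V - 2"
  proof -
    have "{T \<in> set Ts. eigenbasis_value h T = h j} = {T \<in> rooted_subtrees. card T = card V - j}"
      using eigenbasis_value_eq_iff[OF h _ that V] Ts(2) by auto
    then show ?thesis using has_multiplicity_transition_matrix[of "h j"] by simp
  qed
  show "right_eigenfunction rooted_subtrees K (h (card V - card T')) (tree_eigenfunction T')"
    if "T' \<in> rooted_subtrees - {{r}}"
    using that tree tree_eigenfunction_diagonal[of T']
    by (auto simp: right_eigenfunction_def intro!: bexI[of _ T'])
  show "right_eigenfunction rooted_subtrees K 1 (\<lambda>_. 1)"
    using const root_only_in_rooted_subtrees by (auto simp: right_eigenfunction_def)
  have "inj_on eigenbasis_function (rooted_subtrees - {{r}})"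
    using inj_on_eigenfunctions Ts(2) by (auto intro: inj_on_subset)
  then show "inj_on tree_eigenfunction (rooted_subtrees - {{r}})"
    by (auto simp: inj_on_def eigenbasis_function_def)
  have "eigenbasis_function ` set Ts =
      insert (eigenbasis_function {r}) (eigenbasis_function ` (rooted_subtrees - {{r}}))"
    using root_only_in_rooted_subtrees Ts(2) by blast
  also have "\<dots> = insert (\<lambda>_. 1) (tree_eigenfunction ` (rooted_subtrees - {{r}}))"
    by (auto simp: eigenbasis_function_def)
  finally show "function_basis Ts (insert (\<lambda>_. 1) (tree_eigenfunction ` (rooted_subtrees - {{r}})))"
    using function_basis_eigenfunctions by simp
qed

end

theorem theorem5p3:
  fixes V :: "'v set" and r :: 'v and E :: "('v \<times> 'v) set"
    and q\<^sub>2 :: real and n\<^sub>0 :: nat and Ts :: "'v set list"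
  assumes tree: "rooted_tree V r E"
    and n0: "n\<^sub>0 = card V" "n\<^sub>0 \<ge> 2"
    and q2: "0 < q\<^sub>2" "q\<^sub>2 < 1"
    and states: "distinct Ts" "set Ts = rooted_tree.rooted_subtrees V r E"
  defines "S \<equiv> rooted_tree.rooted_subtrees V r E"
    and "K\<^sub>s \<equiv> rooted_tree.single_model V r E"
    and "K\<^sub>b \<equiv> rooted_tree.binomial_model r E q\<^sub>2"
    and "f \<equiv> rooted_tree.tree_eigenfunction r E"
  shows
    "(spectrum (map_mat complex_of_real (transition_matrix Ts K\<^sub>s))
        = {complex_of_real (real j / real n\<^sub>0) | j. j \<le> n\<^sub>0 - 2 \<or> j = n\<^sub>0} \<and>
      spectrum (map_mat complex_of_real (transition_matrix Ts K\<^sub>b))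
        = {complex_of_real (q\<^sub>2 ^ (n\<^sub>0 - j)) | j. j \<le> n\<^sub>0 - 2 \<or> j = n\<^sub>0}) \<and>
     (has_multiplicity (transition_matrix Ts K\<^sub>s) 1 1 \<and>
      has_multiplicity (transition_matrix Ts K\<^sub>b) 1 1 \<and>
      (\<forall>j \<le> n\<^sub>0 - 2.
         has_multiplicity (transition_matrix Ts K\<^sub>s) (real j / real n\<^sub>0)
           (card {T \<in> S. card T = n\<^sub>0 - j}) \<and>
         has_multiplicity (transition_matrix Ts K\<^sub>b) (q\<^sub>2 ^ (n\<^sub>0 - j))
           (card {T \<in> S. card T = n\<^sub>0 - j}))) \<and>
     ((\<forall>T' \<in> S - {{r}}.
         right_eigenfunction S K\<^sub>s ((real n\<^sub>0 - real (card T')) / real n\<^sub>0) (f T') \<and>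
         right_eigenfunction S K\<^sub>b (q\<^sub>2 ^ card T') (f T')) \<and>
      right_eigenfunction S K\<^sub>s 1 (\<lambda>_. 1) \<and>
      right_eigenfunction S K\<^sub>b 1 (\<lambda>_. 1) \<and>
      inj_on f (S - {{r}}) \<and>
      function_basis Ts (insert (\<lambda>_. 1) (f ` (S - {{r}}))))"
proof -
  interpret rooted_tree V r E by (fact tree)
  let ?hs = "\<lambda>j. real j / real n\<^sub>0" and ?hb = "\<lambda>j. q\<^sub>2 ^ (n\<^sub>0 - j)"
  have hs: "inj_on ?hs {..card V}" "?hs (card V) = 1"
    using n0 by (auto simp: inj_on_def)
  \<comment> \<open>Subtraction from \<open>n\<^sub>0\<close> is injective up to
    \<open>n\<^sub>0\<close>, and distinct powers of a number strictly between 0 and 1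
    differ.\<close>
  have hb: "inj_on ?hb {..card V}" "?hb (card V) = 1"
    using n0 q2 by (auto simp: inj_on_def power_inject_exp')
  \<comment> \<open>Translates the index \<open>n\<^sub>0 - card T\<close> back into the size;
    truncated subtraction is harmless because \<open>card T \<le> n\<^sub>0\<close>.\<close>
  have card: "n\<^sub>0 - (n\<^sub>0 - card T) = card T" "real (n\<^sub>0 - card T) = real n\<^sub>0 - real (card T)"
    if "T \<in> rooted_subtrees" for T
    using card_le_card_vertices[OF that] n0 by (auto simp: of_nat_diff)
  have V: "2 \<le> card V" using n0 by simp
  have q: "0 \<le> q\<^sub>2" "q\<^sub>2 \<le> 1" using q2 by auto
  have const_s: "\<forall>T\<in>rooted_subtrees. (\<Sum>y\<in>rooted_subtrees. pmf (single_model T) y) = 1"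
    using single_model_const by blast
  have const_b: "\<forall>T\<in>rooted_subtrees. (\<Sum>y\<in>rooted_subtrees. pmf (binomial_model q\<^sub>2 T) y) = 1"
    using binomial_model_const[OF _ q] by blast
  have tree_s: "\<forall>T\<in>rooted_subtrees. \<forall>T'\<in>rooted_subtrees - {{r}}.
      (\<Sum>y\<in>rooted_subtrees. pmf (single_model T) y * tree_eigenfunction T' y) =
      ?hs (card V - card T') * tree_eigenfunction T' T"
    using single_model_tree_eigenfunction card_rooted_subtree_gt_1 card n0 by simp
  have tree_b: "\<forall>T\<in>rooted_subtrees. \<forall>T'\<in>rooted_subtrees - {{r}}.
      (\<Sum>y\<in>rooted_subtrees. pmf (binomial_model q\<^sub>2 T) y * tree_eigenfunction T' y) =
      ?hb (card V - card T') * tree_eigenfunction T' T"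
    using binomial_model_tree_eigenfunction[OF _ _ q] card_rooted_subtree_gt_1 card n0 by simp
  note single = eigenstructure[OF states V hs const_s tree_s]
  note binomial = eigenstructure[OF states V hb const_b tree_b]
  have "right_eigenfunction rooted_subtrees single_model
      ((real n\<^sub>0 - real (card T')) / real n\<^sub>0) (tree_eigenfunction T')"
    "right_eigenfunction rooted_subtrees (binomial_model q\<^sub>2) (q\<^sub>2 ^ card T') (tree_eigenfunction T')"
    if "T' \<in> rooted_subtrees - {{r}}" for T'
    using single(4)[OF that] binomial(4)[OF that] card[of T'] that n0 by auto
  then show ?thesis
    unfolding S_def K\<^sub>s_def K\<^sub>b_def f_def
    using single(1-3,5-7) binomial(1-3,5) n0(1) by auto
qed

end
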